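(* Let $\mathcal{A}$ be a real symmetric tensor of order $m$ and dimension $n$. Then $\mathcal{A}$ is an almost strictly semi-positive tensor (almost $\mathbf{E}$-tensor) if and only if it is an almost strictly copositive tensor (almost $\mathbf{C}$-tensor).
   Context: A real tensor of order $m$ ($m\ge 2$) and dimension $n$ is an array $\mathcal{A}=(a_{i_1\ldots i_m})$ with $a_{i_1\ldots i_m}\in\mathbb{R}$, $i_1,\ldots,i_m\in I_n=\{1,\ldots,n\}$. It is symmetric if its entries are invariant under all permutations of their indices. For $\mathbf{x}\in\mathbb{R}^n$, $\mathcal{A}\mathbf{x}^{m-1}\in\mathbb{R}^n$ is defined by $(\mathcal{A}\mathbf{x}^{m-1})_i=\sum_{i_2,\ldots,i_m=1}^n a_{i i_2\ldots i_m}x_{i_2}\cdots x_{i_m}$, and $\mathcal{A}\mathbf{x}^m=\sum_{i=1}^n x_i(\mathcal{A}\mathbf{x}^{m-1})_i$. Vector inequalities are componentwise. For nonempty $J\subseteq I_n$, the principal subtensor of $\mathcal{A}$ indexed by $J$ is the tensor of order $m$ and dimension $|J|$ with entries $a_{i_1\ldots i_m}$, $i_1,\ldots,i_m\in J$; it is proper if $J\neq I_n$. $\mathcal{A}$ is strictly semi-positive ($\mathbf{E}$-tensor) if for each $\mathbf{x}\ge\mathbf{0}$, $\mathbf{x}\ne\mathbf{0}$, there is $k\in I_n$ with $x_k>0$ and $(\mathcal{A}\mathbf{x}^{m-1})_k> 0$. $\mathcal{A}$ is almost strictly semi-positive (almost $\mathbf{E}$-tensor) if every proper principal subtensor of $\mathcal{A}$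 is strictly semi-positive and there is $\mathbf{x}>\mathbf{0}$ with $\mathcal{A}\mathbf{x}^{m-1}\le\mathbf{0}$. $\mathcal{A}$ is strictly copositive ($\mathbf{C}$-tensor) if $\mathcal{A}\mathbf{x}^m> 0$ for all $\mathbf{x}\ge\mathbf{0}$, $\mathbf{x}\neq\mathbf{0}$. $\mathcal{A}$ is almost strictly copositive (almost $\mathbf{C}$-tensor) if $\mathcal{A}$ is not strictly copositive but each of its proper principal subtensors is strictly copositive. *)

theory Defs
  imports Complex_Main "HOL-Combinatorics.Permutations"
begin

text \<open>
  A tensor carries its order and its index set, so that its dimension is the cardinality of the
  index set. Only the entries at index lists of length \<open>order\<close> over the index set
  are part of the tensor; likewise a vector is a function of which only the values on the index
  set matter, and all vector conditions below are relativised to that set.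
\<close>

record 'i tensor =
  tensor_order :: nat
  index_set :: "'i set"
  entry :: "'i list \<Rightarrow> real"

definition index_lists :: "'i set \<Rightarrow> nat \<Rightarrow> 'i list set" where
  "index_lists I k = {is. length is = k \<and> set is \<subseteq> I}"

definition symmetric_tensor :: "'i tensor \<Rightarrow> bool" where
  "symmetric_tensor A \<longleftrightarrow>
     (\<forall>is \<in> index_lists (index_set A) (tensor_order A).
      \<forall>p. p permutes {..<tensor_order A} \<longrightarrow> entry A (permute_list p is) = entry A is)"

text \<open>The \<open>i\<close>-th component of the vector \<open>A x^(m-1)\<close>, where \<open>m\<close> is the order of \<open>A\<close>.\<close>

definition tensor_vec :: "'i tensor \<Rightarrow> ('i \<Rightarrow> real) \<Rightarrow> 'i \<Rightarrow> real" where
  "tensor_vec A x i =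
     (\<Sum>is \<in> index_lists (index_set A) (tensor_order A - 1).
        entry A (i # is) * prod_list (map x is))"

text \<open>The form \<open>A x^m\<close>.\<close>

definition tensor_form :: "'i tensor \<Rightarrow> ('i \<Rightarrow> real) \<Rightarrow> real" where
  "tensor_form A x = (\<Sum>i \<in> index_set A. x i * tensor_vec A x i)"

text \<open>
  The indices of a principal subtensor are kept as elements of \<open>J\<close>; they are not renumbered
  to \<open>{1..card J}\<close>.
\<close>

definition principal_subtensor :: "'i tensor \<Rightarrow> 'i set \<Rightarrow> 'i tensor" where
  "principal_subtensor A J = A\<lparr>index_set := J\<rparr>"

definition proper_principal_subtensors :: "'i tensor \<Rightarrow> 'i tensor set" where
  "proper_principal_subtensors A =
     {principal_subtensor A J | J. J \<noteq> {} \<and> J \<subset> index_set A}"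

definition nonneg_nonzero_on :: "'i set \<Rightarrow> ('i \<Rightarrow> real) \<Rightarrow> bool" where
  "nonneg_nonzero_on I x \<longleftrightarrow> (\<forall>i\<in>I. 0 \<le> x i) \<and> (\<exists>i\<in>I. x i \<noteq> 0)"

definition strictly_semipositive :: "'i tensor \<Rightarrow> bool" where
  "strictly_semipositive A \<longleftrightarrow>
     (\<forall>x. nonneg_nonzero_on (index_set A) x \<longrightarrow>
        (\<exists>k \<in> index_set A. 0 < x k \<and> 0 < tensor_vec A x k))"

definition almost_strictly_semipositive :: "'i tensor \<Rightarrow> bool" where
  "almost_strictly_semipositive A \<longleftrightarrow>
     (\<forall>B \<in> proper_principal_subtensors A. strictly_semipositive B) \<and>
     (\<exists>x. (\<forall>i \<in> index_set A. 0 < x i) \<and> (\<forall>i \<in> index_set A. tensor_vec A x i \<le> 0))"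

definition strictly_copositive :: "'i tensor \<Rightarrow> bool" where
  "strictly_copositive A \<longleftrightarrow>
     (\<forall>x. nonneg_nonzero_on (index_set A) x \<longrightarrow> 0 < tensor_form A x)"

definition almost_strictly_copositive :: "'i tensor \<Rightarrow> bool" where
  "almost_strictly_copositive A \<longleftrightarrow>
     \<not> strictly_copositive A \<and>
     (\<forall>B \<in> proper_principal_subtensors A. strictly_copositive B)"

end

theory Submission
  imports Defs "HOL-Analysis.Function_Topology"
begin

text \<open>
  For a symmetric tensor \<open>A\<close> of order \<open>m\<close>, the gradient of the form \<open>A x^m\<close> is
  \<open>m\<close> times the vector \<open>A x^(m-1)\<close>. Over the standard simplex the form has a minimiser
  \<open>x\<close> by compactness. Moving mass between two coordinates of the support of \<open>x\<close> stays inside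
  the simplex, so the gradient is constant on the support; the constant is the minimum itself,
  because \<open>A x^m\<close> is the average of the components of \<open>A x^(m-1)\<close> with weights \<open>x\<close>
  (lemma \<open>tensor_form_simplex_minimiser\<close>). If \<open>A\<close> is not strictly copositive, the minimum is
  nonpositive by homogeneity, and the minimiser is a nonzero nonnegative vector on whose support
  \<open>A x^(m-1)\<close> is nonpositive (lemma \<open>not_strictly_copositive_witness\<close>).

  Two facts follow. Strict semi-positivity and strict copositivity agree for symmetric tensors, in
  particular for all principal subtensors. And if all proper principal subtensors are strictly
  copositive while \<open>A\<close> is not, the witness has full support, since otherwise the subtensor on its
  support would take the same nonpositive value; so it is a positive vector with
  \<open>A x^(m-1) \<le> 0\<close>. Conversely, such a vector gives \<open>A x^m \<le> 0\<close>.
\<close>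

section \<open>The form and its derivative\<close>

lemma finite_index_lists: "finite I \<Longrightarrow> finite (index_lists I k)"
  unfolding index_lists_def using finite_lists_length_eq[of I k] by (simp add: conj_commute)

lemma prod_list_map_conv_nth:
  "prod_list (map f xs) = (\<Prod>k<length xs. f (xs ! k))"
  by (induction xs) (simp_all add: prod.lessThan_Suc_shift del: prod.lessThan_Suc)

lemma sum_index_lists_Suc:
  "(\<Sum>u \<in> index_lists I (Suc k). f u) = (\<Sum>i\<in>I. \<Sum>v \<in> index_lists I k. f (i # v))"
proof -
  have img: "index_lists I (Suc k) = (\<lambda>(i, v). i # v) ` (I \<times> index_lists I k)"
    unfolding index_lists_def by (auto simp: length_Suc_conv image_iff)
  have inj: "inj_on (\<lambda>(i, v). i # v) (I \<times> index_lists I k)"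
    by (auto simp: inj_on_def)
  have "(\<Sum>u \<in> index_lists I (Suc k). f u) = (\<Sum>(i, v) \<in> I \<times> index_lists I k. f (i # v))"
    unfolding img by (subst sum.reindex[OF inj]) (simp add: case_prod_beta comp_def)
  then show ?thesis
    by (simp add: sum.cartesian_product)
qed

lemma tensor_form_conv_sum_index_lists:
  assumes "tensor_order A \<ge> 1"
  shows "tensor_form A x =
    (\<Sum>u \<in> index_lists (index_set A) (tensor_order A). entry A u * prod_list (map x u))"
proof -
  obtain k where k: "tensor_order A = Suc k"
    using assms by (cases "tensor_order A") auto
  show ?thesis
    unfolding tensor_form_def tensor_vec_def k sum_index_lists_Suc
    by (simp add: sum_distrib_left ac_simps)
qed

lemma tensor_form_scale:
  assumes "tensor_order A \<ge> 1"
  shows "tensor_form A (\<lambda>i. c * x i) = c ^ tensor_order A * tensor_form A x"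
proof -
  have "prod_list (map (\<lambda>i. c * x i) u) = c ^ length u * prod_list (map x u)" for u :: "'a list"
    by (induction u) simp_all
  then show ?thesis
    unfolding tensor_form_conv_sum_index_lists[OF assms] sum_distrib_left
    by (intro sum.cong) (auto simp: index_lists_def)
qed

text \<open>
  Symmetry makes the partial derivatives of \<open>A x^m\<close> in its \<open>m\<close> argument slots coincide: a
  transposition of slots carries slot \<open>k\<close> to slot \<open>0\<close>, and slot \<open>0\<close> yields
  \<open>A x^(m-1)\<close> by definition.
\<close>

lemma symmetric_tensor_slot_derivative:
  assumes sym: "symmetric_tensor A" and k: "k < tensor_order A"
  shows "(\<Sum>u \<in> index_lists (index_set A) (tensor_order A).
            entry A u * (h (u ! k) * (\<Prod>j \<in> {..<tensor_order A} - {k}. x (u ! j)))) =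
         (\<Sum>i \<in> index_set A. h i * tensor_vec A x i)"
proof -
  let ?m = "tensor_order A" and ?L = "index_lists (index_set A) (tensor_order A)"
  let ?p = "transpose 0 k"
  let ?s = "\<lambda>k u. h (u ! k) * (\<Prod>j \<in> {..<?m} - {k}. x (u ! j))"
  have p: "?p permutes {..<?m}"
    using k by (intro permutes_swap_id) auto
  have len: "length u = ?m" if "u \<in> ?L" for u
    using that by (simp add: index_lists_def)
  have perm_in: "permute_list ?p u \<in> ?L" if "u \<in> ?L" for u
    using that p by (auto simp: index_lists_def)
  have perm_perm: "permute_list ?p (permute_list ?p u) = u" if "u \<in> ?L" for u
    using permute_list_compose[of ?p u ?p] p len[OF that] by simp
  have entry_perm: "entry A (permute_list ?p u) = entry A u" if "u \<in> ?L" for u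
    using sym that p by (auto simp: symmetric_tensor_def)
  have slot: "?s k (permute_list ?p u) = ?s 0 u" if "u \<in> ?L" for u
  proof -
    have nth: "permute_list ?p u ! j = u ! ?p j" if "j < ?m" for j
      using that p len[OF \<open>u \<in> ?L\<close>] by (intro permute_list_nth) auto
    have bij: "bij_betw ?p ({..<?m} - {k}) ({..<?m} - {0})"
      by (rule bij_betw_byWitness[where f' = ?p])
        (use k in \<open>auto simp: transpose_def\<close>)
    have "(\<Prod>j \<in> {..<?m} - {k}. x (permute_list ?p u ! j)) =
          (\<Prod>j \<in> {..<?m} - {k}. x (u ! ?p j))"
      using nth by (intro prod.cong) auto
    also have "\<dots> = (\<Prod>j \<in> {..<?m} - {0}. x (u ! j))"
      by (rule prod.reindex_bij_betw[OF bij])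
    finally show ?thesis
      using nth[OF k] by simp
  qed
  have "(\<Sum>u \<in> ?L. entry A u * ?s k u) = (\<Sum>u \<in> ?L. entry A u * ?s 0 u)"
    by (rule sum.reindex_bij_witness[where i = "permute_list ?p" and j = "permute_list ?p"])
      (use perm_in perm_perm entry_perm slot in \<open>force+\<close>)
  also have "\<dots> = (\<Sum>i \<in> index_set A. h i * tensor_vec A x i)"
  proof -
    obtain q where q: "?m = Suc q"
      using k by (cases ?m) auto
    have "{..<Suc q} - {0} = Suc ` {..<q}"
      by (auto simp: image_iff less_Suc_eq_0_disj)
    then have tail: "(\<Prod>j \<in> {..<Suc q} - {0}. x ((i # v) ! j)) = prod_list (map x v)"
      if "v \<in> index_lists (index_set A) q" for i v
      using that by (simp add: prod.reindex prod_list_map_conv_nth index_lists_def)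
    show ?thesis
      unfolding tensor_vec_def q sum_index_lists_Suc sum_distrib_left diff_Suc_1
    proof (intro sum.cong refl)
      fix i v assume v: "v \<in> index_lists (index_set A) q"
      show "entry A (i # v) * (h ((i # v) ! 0) * (\<Prod>j \<in> {..<Suc q} - {0}. x ((i # v) ! j))) =
          h i * (entry A (i # v) * prod_list (map x v))"
        unfolding tail[OF v] by simp
    qed
  qed
  finally show ?thesis .
qed

lemma tensor_form_directional_derivative:
  assumes "symmetric_tensor A" and order: "tensor_order A \<ge> 1"
  shows "((\<lambda>t. tensor_form A (\<lambda>i. x i + t * h i)) has_real_derivative
           real (tensor_order A) * (\<Sum>i \<in> index_set A. h i * tensor_vec A x i)) (at 0)"
proof -
  let ?m = "tensor_order A" and ?L = "index_lists (index_set A) (tensor_order A)"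
  have form: "(\<lambda>t. tensor_form A (\<lambda>i. x i + t * h i)) =
      (\<lambda>t. \<Sum>u \<in> ?L. entry A u * (\<Prod>k<?m. x (u ! k) + t * h (u ! k)))"
    unfolding tensor_form_conv_sum_index_lists[OF order]
    by (intro ext sum.cong) (auto simp: prod_list_map_conv_nth index_lists_def)
  have "((\<lambda>t. \<Sum>u \<in> ?L. entry A u * (\<Prod>k<?m. x (u ! k) + t * h (u ! k))) has_real_derivative
      (\<Sum>u \<in> ?L. entry A u *
        (\<Sum>k<?m. h (u ! k) * (\<Prod>j \<in> {..<?m} - {k}. x (u ! j) + 0 * h (u ! j))))) (at 0)"
    by (intro DERIV_sum DERIV_cmult has_field_derivative_prod) (auto intro!: derivative_eq_intros)
  also have "(\<Sum>u \<in> ?L. entry A u *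
        (\<Sum>k<?m. h (u ! k) * (\<Prod>j \<in> {..<?m} - {k}. x (u ! j) + 0 * h (u ! j)))) =
      (\<Sum>k<?m. \<Sum>u \<in> ?L. entry A u * (h (u ! k) * (\<Prod>j \<in> {..<?m} - {k}. x (u ! j))))"
    by (subst sum.swap) (simp add: sum_distrib_left)
  also have "\<dots> = real ?m * (\<Sum>i \<in> index_set A. h i * tensor_vec A x i)"
    using symmetric_tensor_slot_derivative[OF assms(1)] by simp
  finally show ?thesis
    unfolding form .
qed

section \<open>Minimisers on the simplex\<close>

text \<open>
  Vectors are functions on the whole index type. The condition \<open>sum x I = 1\<close> says nothing about
  coordinates outside \<open>I\<close>, so all coordinates are confined to \<open>{0..1}\<close> to obtain a compact set
  in the product topology.
\<close>

lemma compact_simplex: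
  fixes I :: "'i set"
  assumes "finite I"
  shows "compact {x :: 'i \<Rightarrow> real. (\<forall>i. x i \<in> {0..1}) \<and> sum x I = 1}"
proof -
  have "compact (PiE UNIV (\<lambda>_ :: 'i. {0..1 :: real}))"
    using compactin_PiE[of "\<lambda>_ :: 'i. euclidean :: real topology" UNIV "\<lambda>_. {0..1}"]
    by (simp add: euclidean_product_topology)
  moreover have "closed {x :: 'i \<Rightarrow> real. sum x I = 1}"
    by (intro closed_Collect_eq continuous_on_sum continuous_on_const) simp
  ultimately have "compact (PiE UNIV (\<lambda>_ :: 'i. {0..1 :: real}) \<inter> {x. sum x I = 1})"
    by (rule compact_Int_closed)
  moreover have "PiE UNIV (\<lambda>_ :: 'i. {0..1 :: real}) \<inter> {x. sum x I = 1} =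
      {x. (\<forall>i. x i \<in> {0..1}) \<and> sum x I = 1}"
    by (auto simp: PiE_def)
  ultimately show ?thesis by simp
qed

lemma continuous_on_tensor_form:
  "continuous_on (UNIV :: ('i \<Rightarrow> real) set) (tensor_form A)"
  unfolding tensor_form_def tensor_vec_def prod_list_map_conv_nth
  by (intro continuous_intros) simp_all

lemma tensor_form_cong:
  assumes "\<And>i. i \<in> index_set A \<Longrightarrow> x i = y i"
  shows "tensor_form A x = tensor_form A y"
proof -
  have "prod_list (map x u) = prod_list (map y u)" if "u \<in> index_lists (index_set A) k" for u k
    using that assms by (intro arg_cong[of _ _ prod_list] map_cong) (auto simp: index_lists_def)
  then have "tensor_vec A x i = tensor_vec A y i" for i
    unfolding tensor_vec_def by (metis (no_types, lifting) sum.cong)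
  then show ?thesis
    unfolding tensor_form_def using assms by (metis (no_types, lifting) sum.cong)
qed

lemma tensor_form_simplex_minimiser:
  fixes A :: "'i tensor"
  defines "I \<equiv> index_set A"
  assumes sym: "symmetric_tensor A" and order: "tensor_order A \<ge> 1"
    and fin: "finite I" and ne: "I \<noteq> {}"
  obtains x where "\<And>i. i \<in> I \<Longrightarrow> 0 \<le> x i" and "sum x I = 1"
    and "\<And>y. (\<And>i. i \<in> I \<Longrightarrow> 0 \<le> y i) \<Longrightarrow> sum y I = 1 \<Longrightarrow> tensor_form A x \<le> tensor_form A y"
    and "\<And>i. i \<in> I \<Longrightarrow> 0 < x i \<Longrightarrow> tensor_vec A x i = tensor_form A x"
proof -
  let ?S = "{x :: 'i \<Rightarrow> real. (\<forall>i. x i \<in> {0..1}) \<and> sum x I = 1}"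
  \<comment> \<open>A simplex point may have arbitrary values outside \<open>I\<close>; setting them to \<open>0\<close> brings it
    into the compact set without changing the form.\<close>
  have truncate: "(\<lambda>i. if i \<in> I then y i else 0) \<in> ?S"
    if "\<And>i. i \<in> I \<Longrightarrow> 0 \<le> y i" "sum y I = 1" for y
  proof -
    have "y i \<le> 1" if "i \<in> I" for i
      using member_le_sum[of i I y] that fin \<open>sum y I = 1\<close> \<open>\<And>i. i \<in> I \<Longrightarrow> 0 \<le> y i\<close> by simp
    then show ?thesis
      using that by simp
  qed
  have "(\<lambda>i. if i \<in> I then 1 / real (card I) else 0) \<in> ?S"
    using fin ne by (intro truncate) auto
  then have "?S \<noteq> {}"
    by (metis (no_types, lifting) empty_iff)
  moreover have "continuous_on ?S (tensor_form A)"
    using continuous_on_subset[OF continuous_on_tensor_form] by simp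
  ultimately obtain x where xS: "x \<in> ?S"
    and x_min: "\<forall>y\<in>?S. tensor_form A x \<le> tensor_form A y"
    using continuous_attains_inf[OF compact_simplex[OF fin]] by blast
  have nonneg: "0 \<le> x i" for i
    using xS by simp
  have sum1: "sum x I = 1"
    using xS by simp
  have le: "tensor_form A x \<le> tensor_form A y"
    if "\<And>i. i \<in> I \<Longrightarrow> 0 \<le> y i" "sum y I = 1" for y
  proof -
    have "tensor_form A y = tensor_form A (\<lambda>i. if i \<in> I then y i else 0)"
      by (intro tensor_form_cong) (simp add: I_def)
    then show ?thesis
      using x_min truncate[OF that] by simp
  qed
  have eq: "tensor_vec A x i = tensor_vec A x j"
    if ij: "i \<in> I" "j \<in> I" "0 < x i" "0 < x j" for i j
  proof (cases "i = j")
    case False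
    \<comment> \<open>Along \<open>e_i - e_j\<close> the point \<open>x\<close> can move both ways inside the simplex, so the
      derivative of the form vanishes there.\<close>
    define h :: "'i \<Rightarrow> real" where "h = (\<lambda>l. of_bool (l = i) - of_bool (l = j))"
    have sum_h: "(\<Sum>l\<in>I. h l * f l) = f i - f j" for f
      unfolding h_def left_diff_distrib sum_subtractf
      using ij fin by (simp add: of_bool_def if_distrib[of "\<lambda>c. c * _"] cong: if_cong)
    have "tensor_form A (\<lambda>l. x l + 0 * h l) \<le> tensor_form A (\<lambda>l. x l + t * h l)"
      if t: "\<bar>0 - t\<bar> < min (x i) (x j)" for t
    proof -
      have "0 \<le> x l + t * h l" for l
        using t nonneg[of l] False by (auto simp: h_def)
      moreover have "(\<Sum>l\<in>I. x l + t * h l) = 1"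
        using sum_h[of "\<lambda>_. 1"] sum1 by (simp add: sum.distrib flip: sum_distrib_left)
      ultimately show ?thesis
        using le[of "\<lambda>l. x l + t * h l"] by simp
    qed
    then have "real (tensor_order A) * (\<Sum>l \<in> index_set A. h l * tensor_vec A x l) = 0"
      using ij by (intro DERIV_local_min[OF tensor_form_directional_derivative[OF sym order],
            of "min (x i) (x j)"]) auto
    then show ?thesis
      using order sum_h[of "tensor_vec A x"] by (auto simp: I_def)
  qed simp
  have "tensor_vec A x i = tensor_form A x" if "i \<in> I" "0 < x i" for i
  proof -
    have "tensor_form A x = (\<Sum>l\<in>I. x l * tensor_vec A x i)"
      unfolding tensor_form_def I_def
    proof (intro sum.cong refl)
      fix l assume "l \<in> index_set A"
      then show "x l * tensor_vec A x l = x l * tensor_vec A x i"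
        using eq[of l i] that nonneg[of l] by (cases "x l = 0") (auto simp: I_def)
    qed
    then show ?thesis
      using sum1 by (simp flip: sum_distrib_right)
  qed
  then show ?thesis
    using that nonneg sum1 le by blast
qed

lemma not_strictly_copositive_witness:
  assumes sym: "symmetric_tensor A" and order: "tensor_order A \<ge> 1"
    and fin: "finite (index_set A)" and not_cop: "\<not> strictly_copositive A"
  obtains x where "nonneg_nonzero_on (index_set A) x" and "tensor_form A x \<le> 0"
    and "\<And>i. i \<in> index_set A \<Longrightarrow> 0 < x i \<Longrightarrow> tensor_vec A x i \<le> 0"
proof -
  let ?I = "index_set A"
  obtain y where y: "nonneg_nonzero_on ?I y" and form_y: "tensor_form A y \<le> 0"
    using not_cop by (auto simp: strictly_copositive_def not_less)
  define s where "s = sum y ?I"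
  have "s > 0"
    using y fin unfolding s_def nonneg_nonzero_on_def
    by (metis order_le_less sum_nonneg sum_nonneg_eq_0_iff)
  have "?I \<noteq> {}"
    using y by (auto simp: nonneg_nonzero_on_def)
  obtain x where x: "\<And>i. i \<in> ?I \<Longrightarrow> 0 \<le> x i" "sum x ?I = 1"
    and min: "\<And>z. (\<And>i. i \<in> ?I \<Longrightarrow> 0 \<le> z i) \<Longrightarrow> sum z ?I = 1 \<Longrightarrow> tensor_form A x \<le> tensor_form A z"
    and vec: "\<And>i. i \<in> ?I \<Longrightarrow> 0 < x i \<Longrightarrow> tensor_vec A x i = tensor_form A x"
    using tensor_form_simplex_minimiser[OF sym order fin \<open>?I \<noteq> {}\<close>] by blast
  have "tensor_form A x \<le> tensor_form A (\<lambda>i. inverse s * y i)"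
    using y \<open>s > 0\<close>
    by (intro min) (auto simp: nonneg_nonzero_on_def s_def simp flip: sum_distrib_left)
  also have "\<dots> \<le> 0"
    using form_y \<open>s > 0\<close> by (simp add: tensor_form_scale[OF order] mult_nonneg_nonpos)
  finally have form_x: "tensor_form A x \<le> 0" .
  have "\<exists>i\<in>?I. x i \<noteq> 0"
    using x(2) by (metis sum.neutral zero_neq_one)
  then show ?thesis
    using that[of x] x(1) form_x vec by (auto simp: nonneg_nonzero_on_def)
qed

section \<open>Strict and almost strict notions\<close>

lemma strictly_copositive_imp_strictly_semipositive:
  assumes "strictly_copositive A"
  shows "strictly_semipositive A"
  unfolding strictly_semipositive_def
proof (intro allI impI)
  fix x assume x: "nonneg_nonzero_on (index_set A) x"
  then have "0 < (\<Sum>i \<in> index_set A. x i * tensor_vec A x i)"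
    using assms by (simp add: strictly_copositive_def tensor_form_def)
  then obtain k where "k \<in> index_set A" "0 < x k * tensor_vec A x k"
    by (meson not_le sum_nonpos)
  then show "\<exists>k \<in> index_set A. 0 < x k \<and> 0 < tensor_vec A x k"
    using x by (auto simp: nonneg_nonzero_on_def zero_less_mult_iff)
qed

lemma strictly_semipositive_iff_strictly_copositive:
  assumes "symmetric_tensor A" and "tensor_order A \<ge> 1" and "finite (index_set A)"
  shows "strictly_semipositive A \<longleftrightarrow> strictly_copositive A"
proof
  assume semi: "strictly_semipositive A"
  show "strictly_copositive A"
  proof (rule ccontr)
    assume "\<not> strictly_copositive A"
    with assms obtain x where "nonneg_nonzero_on (index_set A) x"
      and "\<And>i. i \<in> index_set A \<Longrightarrow> 0 < x i \<Longrightarrow> tensor_vec A x i \<le> 0"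
      by (metis not_strictly_copositive_witness)
    with semi show False
      by (force simp: strictly_semipositive_def)
  qed
qed (rule strictly_copositive_imp_strictly_semipositive)

lemma principal_subtensor_simps [simp]:
  "tensor_order (principal_subtensor A J) = tensor_order A"
  "index_set (principal_subtensor A J) = J"
  "entry (principal_subtensor A J) = entry A"
  by (simp_all add: principal_subtensor_def)

lemma symmetric_tensor_principal_subtensor:
  assumes "symmetric_tensor A" and "J \<subseteq> index_set A"
  shows "symmetric_tensor (principal_subtensor A J)"
  using assms by (auto simp: symmetric_tensor_def index_lists_def)

lemma tensor_form_principal_subtensor:
  assumes order: "tensor_order A \<ge> 1" and fin: "finite (index_set A)" and sub: "J \<subseteq> index_set A"
    and zero: "\<And>i. i \<in> index_set A - J \<Longrightarrow> x i = 0"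
  shows "tensor_form (principal_subtensor A J) x = tensor_form A x"
proof -
  have "prod_list (map x u) = 0"
    if "u \<in> index_lists (index_set A) k - index_lists J k" for u k
    using that zero by (force simp: index_lists_def prod_list_zero_iff)
  then show ?thesis
    using order fin sub
    by (simp add: tensor_form_conv_sum_index_lists)
      (intro sum.mono_neutral_left finite_index_lists, auto simp: index_lists_def)
qed

lemma almost_strictly_copositive_full_support:
  assumes cop: "almost_strictly_copositive A" and "tensor_order A \<ge> 1" and "finite (index_set A)"
    and x: "nonneg_nonzero_on (index_set A) x" and form: "tensor_form A x \<le> 0"
  shows "\<forall>i \<in> index_set A. 0 < x i"
proof (rule ccontr)
  assume not_pos: "\<not> (\<forall>i \<in> index_set A. 0 < x i)"
  define J where "J = {i \<in> index_set A. x i \<noteq> 0}"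
  have J: "J \<noteq> {}" "J \<subset> index_set A"
    using x not_pos by (force simp: J_def nonneg_nonzero_on_def)+
  then have "strictly_copositive (principal_subtensor A J)"
    using cop by (auto simp: almost_strictly_copositive_def proper_principal_subtensors_def)
  moreover have "nonneg_nonzero_on J x"
    using x by (auto simp: nonneg_nonzero_on_def J_def)
  ultimately have "0 < tensor_form (principal_subtensor A J) x"
    by (simp add: strictly_copositive_def)
  also have "\<dots> = tensor_form A x"
    using assms J by (intro tensor_form_principal_subtensor) (auto simp: J_def)
  finally show False
    using form by simp
qed

theorem theorem15:
  fixes A :: "nat tensor" and m n :: nat
  assumes "m \<ge> 2" and "n \<ge> 1"
    and "tensor_order A = m" and "index_set A = {1..n}"
    and "symmetric_tensor A"
  shows "almost_strictly_semipositive A \<longleftrightarrow> almost_strictly_copositive A"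
proof -
  let ?I = "index_set A"
  have order: "tensor_order A \<ge> 1" and fin: "finite ?I" and ne: "?I \<noteq> {}"
    using assms by auto
  have subtensors: "strictly_semipositive B \<longleftrightarrow> strictly_copositive B"
    if "B \<in> proper_principal_subtensors A" for B
  proof -
    obtain J where B: "B = principal_subtensor A J" and J: "J \<subset> ?I"
      using \<open>B \<in> proper_principal_subtensors A\<close> by (auto simp: proper_principal_subtensors_def)
    then show ?thesis
      using assms(5) order fin finite_subset[of J ?I]
      by (intro strictly_semipositive_iff_strictly_copositive)
        (auto intro: symmetric_tensor_principal_subtensor)
  qed
  show ?thesis
  proof
    assume semi: "almost_strictly_semipositive A"
    then obtain x where pos: "\<forall>i\<in>?I. 0 < x i" and vec: "\<forall>i\<in>?I. tensor_vec A x i \<le> 0"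
      by (auto simp: almost_strictly_semipositive_def)
    have "tensor_form A x \<le> 0"
      unfolding tensor_form_def
      using pos vec by (intro sum_nonpos mult_nonneg_nonpos) (auto simp: less_imp_le)
    moreover have "nonneg_nonzero_on ?I x"
      using pos ne by (force simp: nonneg_nonzero_on_def)
    ultimately have "\<not> strictly_copositive A"
      by (force simp: strictly_copositive_def)
    then show "almost_strictly_copositive A"
      using semi subtensors
      by (simp add: almost_strictly_copositive_def almost_strictly_semipositive_def)
  next
    assume cop: "almost_strictly_copositive A"
    then have "\<not> strictly_copositive A"
      by (simp add: almost_strictly_copositive_def)
    then obtain x where x: "nonneg_nonzero_on ?I x" "tensor_form A x \<le> 0"
      and vec: "\<And>i. i \<in> ?I \<Longrightarrow> 0 < x i \<Longrightarrow> tensor_vec A x i \<le> 0"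
      using not_strictly_copositive_witness[OF assms(5) order fin] by blast
    have "\<forall>i\<in>?I. 0 < x i"
      using almost_strictly_copositive_full_support[OF cop order fin x] .
    then show "almost_strictly_semipositive A"
      using cop subtensors vec
      by (auto simp: almost_strictly_copositive_def almost_strictly_semipositive_def)
  qed
qed

end
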